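(* Let $1<p<\infty$ and let $d\ge 3$ be an integer. There exist a nonnegative locally integrable weight $w$ and a positive locally integrable weight $v$ on $\mathbb R^d$ such that $$A_{p,d}^+(w,v)<\infty \qquad\text{and}\qquad \|M_d^+\|_{L^p(v)\to L^{p,\infty}(w)}=\infty .$$
   Context: For $d\ge 1$ the one-sided maximal operator on $\mathbb R^d$ is $$M_d^+f(x)=\sup_{h>0}\frac1{h^d}\int_{x+[0,h]^d}|f(y)|\,dy,\qquad x\in\mathbb R^d.$$ For a weight $u$ and measurable $E$, $u(E)=\int_E u(x)\,dx$. Given weights $w\ge 0$, $v>0$ and $1<p<\infty$, put $\sigma=v^{-1/(p-1)}$. For $a\in\mathbb R^d$, $h>0$ let $Q^-=\prod_{j=1}^d[a_j-h,a_j]$ and $Q^+=\prod_{j=1}^d[a_j,a_j+h]$, and $$A_{p,d}^+(w,v)=\sup_{a\in\mathbb R^d,\ h>0}\frac{w(Q^-)\,\sigma(Q^+)^{p-1}}{h^{dp}}.$$ Norms: $\|f\|_{L^p(v)}=(\int|f|^p v)^{1/p}$ and $\|g\|_{L^{p,\infty}(w)}=\sup_{\lambda>0}\lambda\, w(\{|g|>\lambda\})^{1/p}$. The quantity $\|M_d^+\|_{L^p(v)\to L^{p,\infty}(w)}$ is the smallest $C\in[0,\infty]$ with $\|M_d^+f\|_{L^{p,\infty}(w)}\le C\|f\|_{L^p(v)}$ for all $f\in L^p(v)$; it is $\infty$ if no finite $C$ works. *)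

theory Defs
  imports "HOL-Analysis.Analysis"
begin

text \<open>
  All integrals are Lebesgue integrals of nonnegative functions with values in \<^typ>\<open>ennreal\<close>, with
  respect to the completed measure \<^const>\<open>lebesgue\<close>. A product of 0 and infinity is 0, as
  usual in measure theory.
\<close>

text \<open>Real powers of extended nonnegative numbers, for positive exponents \<open>a\<close> only.\<close>

definition ennreal_powr :: "ennreal \<Rightarrow> real \<Rightarrow> ennreal" where
  "ennreal_powr x a = (if x = \<infinity> then \<infinity> else ennreal (enn2real x powr a))"

definition locally_integrable :: "(real ^ 'n \<Rightarrow> real) \<Rightarrow> bool" where
  "locally_integrable u \<longleftrightarrow>
     u \<in> borel_measurable lebesgue \<and> (\<forall>K. compact K \<longrightarrow> set_integrable lebesgue K u)"

definition weighted_measure :: "(real ^ 'n \<Rightarrow> real) \<Rightarrow> (real ^ 'n) set \<Rightarrow> ennreal" where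
  "weighted_measure u E = (\<integral>\<^sup>+x\<in>E. ennreal (u x) \<partial>lebesgue)"

text \<open>\<open>vec h\<close> is the vector all of whose coordinates are \<open>h\<close>, so that \<open>cbox x (x + vec h)\<close> is
  the cube \<open>x + [0,h]\<^sup>d\<close>.\<close>

definition one_sided_maximal :: "(real ^ 'n \<Rightarrow> real) \<Rightarrow> real ^ 'n \<Rightarrow> ennreal" where
  "one_sided_maximal f x =
     (SUP h\<in>{0<..}. (\<integral>\<^sup>+y\<in>cbox x (x + vec h). ennreal \<bar>f y\<bar> \<partial>lebesgue) / ennreal (h ^ CARD('n)))"

definition dual_weight :: "real \<Rightarrow> (real ^ 'n \<Rightarrow> real) \<Rightarrow> real ^ 'n \<Rightarrow> real" where
  "dual_weight p v x = v x powr (- (1 / (p - 1)))"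

definition A_plus :: "real \<Rightarrow> (real ^ 'n \<Rightarrow> real) \<Rightarrow> (real ^ 'n \<Rightarrow> real) \<Rightarrow> ennreal" where
  "A_plus p w v =
     (SUP a. SUP h\<in>{0<..}.
        weighted_measure w (cbox (a - vec h) a) *
        ennreal_powr (weighted_measure (dual_weight p v) (cbox a (a + vec h))) (p - 1) /
        ennreal (h powr (real CARD('n) * p)))"

definition Lp_norm :: "real \<Rightarrow> (real ^ 'n \<Rightarrow> real) \<Rightarrow> (real ^ 'n \<Rightarrow> real) \<Rightarrow> ennreal" where
  "Lp_norm p v f = ennreal_powr (\<integral>\<^sup>+x. ennreal (\<bar>f x\<bar> powr p * v x) \<partial>lebesgue) (1 / p)"

definition Lp_space :: "real \<Rightarrow> (real ^ 'n \<Rightarrow> real) \<Rightarrow> (real ^ 'n \<Rightarrow> real) set" where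
  "Lp_space p v = {f. f \<in> borel_measurable lebesgue \<and> Lp_norm p v f < \<infinity>}"

text \<open>The argument \<open>g\<close> plays the role of an absolute value and may be infinite, as maximal
  functions may be.\<close>

definition weak_Lp_norm :: "real \<Rightarrow> (real ^ 'n \<Rightarrow> real) \<Rightarrow> (real ^ 'n \<Rightarrow> ennreal) \<Rightarrow> ennreal" where
  "weak_Lp_norm p w g =
     (SUP l\<in>{0<..}. ennreal l * ennreal_powr (weighted_measure w {x. ennreal l < g x}) (1 / p))"

text \<open>The infimum ranges over extended constants, so it is infinite if no finite one works.\<close>

definition maximal_weak_type_norm :: "real \<Rightarrow> (real ^ 'n \<Rightarrow> real) \<Rightarrow> (real ^ 'n \<Rightarrow> real) \<Rightarrow> ennreal" where
  "maximal_weak_type_norm p v w =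
     Inf {C. \<forall>f\<in>Lp_space p v. weak_Lp_norm p w (one_sided_maximal f) \<le> C * Lp_norm p v f}"

end

theory Submission
  imports Defs
begin

text \<open>
  Three coordinate directions suffice; nothing depends on the others. Let \<open>K\<close> be a depth and consider
  the 8-ary tree of depth \<open>K\<close>. Its leaves are tiny bricks whose second and third coordinates lie on an
  antidiagonal, so that they are pairwise incomparable. A node of level \<open>k\<close> is a brick placed just
  below (in the second and third coordinates) exactly the leaves that descend from it, and at distance
  about \<open>1 / 2 ^ k\<close> from them in the first coordinate. The weight \<open>w\<close> lives on the nodes, the dual weight
  mostly on the leaves, and, up to normalization, both the node and the set of leaves below it have mass
  \<open>1 / 8 ^ k\<close>.

  If \<open>Q\<^sup>-\<close> meets nodes and \<open>Q\<^sup>+\<close> meets leaves, then each of these nodes lies below each of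
  these leaves and therefore is an ancestor of it. So the nodes form a chain, and if \<open>k\<close> is the level of the
  topmost one, both masses are at most of order \<open>1 / 8 ^ k\<close>, whereas the side of the cubes is at
  least of order \<open>1 / 2 ^ k\<close>: the \<open>A\<^sub>p\<close> condition holds uniformly in \<open>K\<close>. On the other hand
  the maximal function of the indicator of the leaves is bounded below on all nodes, and each of the
  \<open>K + 1\<close> levels has the same total mass as the leaves, so the weak type constant grows with \<open>K\<close>.
  Trees of all depths are placed side by side along the antidiagonal, where they do not interact.
\<close>

section \<open>Preliminaries on weights, powers and boxes\<close>

lemma locally_integrable_bounded:
  fixes u :: "real ^ 'n \<Rightarrow> real"
  assumes "u \<in> borel_measurable lebesgue" "\<And>x. \<bar>u x\<bar> \<le> B"
  shows "locally_integrable u"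
  unfolding locally_integrable_def
proof (intro conjI allI impI assms(1))
  fix K :: "(real ^ 'n) set"
  assume K: "compact K"
  have fin: "emeasure lebesgue K < \<infinity>"
    using fmeasurableD2[OF lmeasurable_compact[OF K]] by (simp add: less_top)
  show "set_integrable lebesgue K u"
    unfolding set_integrable_def
  proof (rule integrableI_bounded_set[where A = K and B = B], goal_cases)
    have "K \<in> sets lebesgue" using K by (simp add: compact_imp_closed borel_closed)
    then show "K \<in> sets lebesgue" "(\<lambda>x. indicat_real K x *\<^sub>R u x) \<in> borel_measurable lebesgue"
      using assms(1) by measurable
  next
    case 4
    show ?case
      using assms(2) order_trans[OF abs_ge_zero assms(2)] by (auto simp: indicator_def)
  qed (use fin in \<open>auto simp: indicator_def\<close>)
qed

lemma weighted_measure_mono: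
  assumes "A \<subseteq> B"
  shows "weighted_measure u A \<le> weighted_measure u B"
  unfolding weighted_measure_def using assms
  by (intro nn_integral_mono) (auto simp: indicator_def)

lemma weighted_measure_indicator:
  assumes "S \<in> sets lebesgue" "E \<in> sets lebesgue"
  shows "weighted_measure (indicator S) E = emeasure lebesgue (S \<inter> E)"
proof -
  have "weighted_measure (indicator S) E = (\<integral>\<^sup>+x. indicator (S \<inter> E) x \<partial>lebesgue)"
    unfolding weighted_measure_def by (intro nn_integral_cong) (auto simp: indicator_def)
  then show ?thesis using assms by simp
qed

lemma ennreal_powr_mono:
  assumes "x \<le> y" "0 \<le> a"
  shows "ennreal_powr x a \<le> ennreal_powr y a"
  using assms unfolding ennreal_powr_def
  by (auto simp: top_unique enn2real_mono less_top intro!: ennreal_leI powr_mono2)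

lemma ennreal_powr_ennreal: "0 \<le> r \<Longrightarrow> ennreal_powr (ennreal r) a = ennreal (r powr a)"
  by (simp add: ennreal_powr_def)

lemma emeasure_UN_le_card:
  assumes "finite I" "\<And>i. i \<in> I \<Longrightarrow> S i \<in> sets M"
    and "\<And>i. i \<in> I \<Longrightarrow> emeasure M (S i) \<le> ennreal (c i)" "\<And>i. i \<in> I \<Longrightarrow> 0 \<le> c i"
  shows "emeasure M (\<Union>i\<in>I. S i) \<le> ennreal (\<Sum>i\<in>I. c i)"
proof -
  have "emeasure M (\<Union>i\<in>I. S i) \<le> (\<Sum>i\<in>I. emeasure M (S i))"
    using assms by (intro emeasure_subadditive_finite) auto
  also have "\<dots> \<le> (\<Sum>i\<in>I. ennreal (c i))" using assms by (intro sum_mono) auto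
  finally show ?thesis using assms by simp
qed

text \<open>Only the coordinates in \<open>D\<close> carry individual intervals; the others share
  the length \<open>s\<close> and enter as one power. \<open>D\<close> consists of the three
  directions for bricks and is empty for cubes.\<close>

lemma emeasure_cbox_cart:
  fixes l u z :: "'n::finite \<Rightarrow> real"
  assumes "\<And>i. i \<in> D \<Longrightarrow> l i \<le> u i" "0 \<le> s"
  shows "emeasure lebesgue {x :: real ^ 'n. \<forall>i. x $ i \<in> (if i \<in> D then {l i..u i} else {z i..z i + s})}
    = ennreal ((\<Prod>i\<in>D. u i - l i) * s ^ (CARD('n) - card D))"
proof -
  define a b :: "real ^ 'n" where "a = (\<chi> i. if i \<in> D then l i else z i)"
    and "b = (\<chi> i. if i \<in> D then u i else z i + s)"
  have set: "{x :: real ^ 'n. \<forall>i. x $ i \<in> (if i \<in> D then {l i..u i} else {z i..z i + s})} = cbox a b"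
    unfolding a_def b_def by (auto simp: mem_box_cart split: if_splits)
  have le: "a $ i \<le> b $ i" for i using assms by (auto simp: a_def b_def)
  then have "measure lebesgue (cbox a b) = (\<Prod>i\<in>UNIV. b $ i - a $ i)"
    using content_cbox_cart[of a b] by (force simp: interval_eq_empty_cart not_less simp flip: not_le)
  also have "\<dots> = (\<Prod>i\<in>D. b $ i - a $ i) * (\<Prod>i\<in>-D. b $ i - a $ i)"
    by (subst prod.union_disjoint[symmetric]) (auto intro!: prod.cong)
  also have "\<dots> = (\<Prod>i\<in>D. u i - l i) * s ^ (CARD('n) - card D)"
    by (simp add: a_def b_def card_Diff_subset Compl_eq_Diff_UNIV)
  finally show ?thesis
    unfolding set by (subst emeasure_eq_measure2) (auto simp: emeasure_lborel_cbox_eq)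
qed

subsection \<open>Trees of bricks\<close>

text \<open>
  The scale of the antidiagonal in the tree of depth \<open>K\<close>; it is so small that the \<open>8 ^
  K\<close> leaves, at mutual distance \<open>4 * eps K\<close>, fit into a square of side \<open>1 / 2 ^
  K\<close>.
\<close>

definition eps :: "nat \<Rightarrow> real" where "eps K = 1 / 16 ^ (K + 1)"

lemma eps_pos: "0 < eps K" by (simp add: eps_def)

lemma eps_bound: "eps K * (4 * 8 ^ K) = 1 / (4 * 2 ^ K)"
proof -
  have "(16 :: real) ^ K = 8 ^ K * 2 ^ K" by (simp flip: power_mult_distrib)
  then show ?thesis by (simp add: eps_def field_simps)
qed

lemma eps_bound_1: "eps K * (4 * 8 ^ K) \<le> 1"
proof -
  have "(1 :: real) \<le> 4 * 2 ^ K" using one_le_power[of "2 :: real" K] by linarith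
  then show ?thesis unfolding eps_bound by (simp add: field_simps)
qed

lemma eps_le_1: "eps K \<le> 1"
  unfolding eps_def
  by (simp only: divide_le_eq_1_pos zero_less_power zero_less_numeral) (rule one_le_power, simp)

locale three_directions =
  fixes e1 e2 e3 :: "'n::finite"
  assumes distinct: "e1 \<noteq> e2" "e1 \<noteq> e3" "e2 \<noteq> e3"
begin

text \<open>
  The sign of the third coordinate is reversed, so that the second and third intervals of bricks along the
  antidiagonal agree up to small shifts.
\<close>

definition brick :: "real \<Rightarrow> real \<Rightarrow> real \<Rightarrow> real \<Rightarrow> real \<Rightarrow> real \<Rightarrow> (real ^ 'n) set" where
  "brick a1 b1 a2 b2 a3 b3 =
     {x. x $ e1 \<in> {a1..b1} \<and> x $ e2 \<in> {a2..b2} \<and> - x $ e3 \<in> {a3..b3}}"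

text \<open>Bricks are unbounded in the remaining coordinates, so volumes are taken inside such
  slabs. A cube of side \<open>h\<close> lies in one, which contributes the factor
  \<open>h ^ (CARD('n) - 3)\<close>.\<close>

definition side :: "('n \<Rightarrow> real) \<Rightarrow> real \<Rightarrow> (real ^ 'n) set" where
  "side z s = {x. \<forall>i. i \<notin> {e1, e2, e3} \<longrightarrow> x $ i \<in> {z i..z i + s}}"

lemma brick_sets [measurable]: "brick a1 b1 a2 b2 a3 b3 \<in> sets borel"
  unfolding brick_def by measurable

lemma side_sets [measurable]: "side z s \<in> sets borel"
  unfolding side_def by measurable

lemma cbox_subset_side: "cbox x (x + vec h) \<subseteq> side (($) x) h"
  by (auto simp: side_def mem_box_cart)

lemma emeasure_brick_side:
  assumes "a1 \<le> b1" "a2 \<le> b2" "a3 \<le> b3" "0 \<le> s"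
  shows "emeasure lborel (brick a1 b1 a2 b2 a3 b3 \<inter> side z s)
    = ennreal ((b1 - a1) * (b2 - a2) * (b3 - a3) * s ^ (CARD('n) - 3))"
proof -
  define l u where "l i = (if i = e1 then a1 else if i = e2 then a2 else - b3)"
    and "u i = (if i = e1 then b1 else if i = e2 then b2 else - a3)" for i
  have "brick a1 b1 a2 b2 a3 b3 \<inter> side z s =
      {x. \<forall>i. x $ i \<in> (if i \<in> {e1, e2, e3} then {l i..u i} else {z i..z i + s})}"
    using distinct by (auto simp: brick_def side_def l_def u_def split: if_splits)
  also have "emeasure lebesgue \<dots> =
      ennreal ((\<Prod>i\<in>{e1, e2, e3}. u i - l i) * s ^ (CARD('n) - card {e1, e2, e3}))"
    using assms by (intro emeasure_cbox_cart) (auto simp: l_def u_def)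
  finally show ?thesis using distinct by (simp add: l_def u_def mult.assoc eval_nat_numeral)
qed

text \<open>
  Trees of different depth \<open>K\<close> are separated by the shift \<open>4 * K\<close> along the
  antidiagonal. The leaves below the node \<open>(k, j)\<close> are those with \<open>i div 8 ^ (K - k) =
  j\<close>; the second interval of \<open>node K k j\<close> ends where the first of these leaves begins, and
  its third interval begins where the last one ends. The first interval puts it at distance of order \<open>1
  / 2 ^ k\<close> from all leaves. All bricks have volume \<open>(eps K)\<^sup>2 / 8 ^ k\<close> (with
  \<open>k = K\<close> for leaves).
\<close>

definition node :: "nat \<Rightarrow> nat \<Rightarrow> nat \<Rightarrow> (real ^ 'n) set" where
  "node K k j = brick (- (1 / 2 ^ k) - 1 / 8 ^ k) (- (1 / 2 ^ k))
     (4 * real K + eps K * (4 * real j * 8 ^ (K - k) - 1))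
     (4 * real K + eps K * (4 * real j * 8 ^ (K - k)))
     (4 * real K + eps K * (4 * (real j + 1) * 8 ^ (K - k) - 4))
     (4 * real K + eps K * (4 * (real j + 1) * 8 ^ (K - k) - 3))"

definition leaf :: "nat \<Rightarrow> nat \<Rightarrow> (real ^ 'n) set" where
  "leaf K i = brick 0 (1 / 8 ^ K)
     (4 * real K + eps K * (4 * real i)) (4 * real K + eps K * (4 * real i + 1))
     (4 * real K + eps K * (4 * real i - 1)) (4 * real K + eps K * (4 * real i))"

lemma node_sets [measurable]: "node K k j \<in> sets borel" unfolding node_def by measurable
lemma leaf_sets [measurable]: "leaf K k \<in> sets borel" unfolding leaf_def by measurable

lemma emeasure_node_side:
  "0 \<le> s \<Longrightarrow> emeasure lborel (node K k j \<inter> side z s) = ennreal ((eps K)\<^sup>2 / 8 ^ k * s ^ (CARD('n) - 3))"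
  unfolding node_def using eps_pos[of K]
  by (subst emeasure_brick_side) (auto simp: power2_eq_square algebra_simps)

lemma emeasure_leaf_side:
  "0 \<le> s \<Longrightarrow> emeasure lborel (leaf K i \<inter> side z s) = ennreal ((eps K)\<^sup>2 / 8 ^ K * s ^ (CARD('n) - 3))"
  unfolding leaf_def using eps_pos[of K]
  by (subst emeasure_brick_side) (auto simp: power2_eq_square algebra_simps)

lemma node_index_bound:
  assumes "k \<le> K" "j < 8 ^ k"
  shows "(real j + 1) * 8 ^ (K - k) \<le> 8 ^ K"
proof -
  have "(j + 1) * 8 ^ (K - k) \<le> 8 ^ k * 8 ^ (K - k)"
    using assms(2) by (intro mult_right_mono) auto
  also have "\<dots> = 8 ^ K" using assms(1) by (simp flip: power_add)
  finally have "real ((j + 1) * 8 ^ (K - k)) \<le> real (8 ^ K)" unfolding of_nat_le_iff .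
  then show ?thesis by (simp add: algebra_simps)
qed

text \<open>The two coordinates run in opposite directions along the antidiagonal: the second bounds
  \<open>i\<close> from below and the third from above, which pins \<open>i\<close> to the block of
  leaves below the node.\<close>

lemma node_below_leaf:
  assumes x: "x \<in> node K k j" "k \<le> K" "j < 8 ^ k" and y: "y \<in> leaf L i" "i < 8 ^ L"
    and le: "x $ e2 \<le> y $ e2" "x $ e3 \<le> y $ e3"
  shows "K = L" "i div 8 ^ (K - k) = j"
proof -
  let ?B = "8 ^ (K - k) :: real"
  have x2: "4 * real K + eps K * (4 * real j * ?B - 1) \<le> x $ e2"
    and x3: "- x $ e3 \<le> 4 * real K + eps K * (4 * (real j + 1) * ?B - 3)"
    using x(1) by (auto simp: node_def brick_def)
  have y2: "y $ e2 \<le> 4 * real L + eps L * (4 * real i + 1)" and y3: "4 * real L + eps L * (4 * real i - 1) \<le> - y $ e3"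
    using y(1) by (auto simp: leaf_def brick_def)
  have A: "4 * real K + eps K * (4 * real j * ?B - 1) \<le> 4 * real L + eps L * (4 * real i + 1)"
    using x2 y2 le by linarith
  have B: "4 * real L + eps L * (4 * real i - 1) \<le> 4 * real K + eps K * (4 * (real j + 1) * ?B - 3)"
    using x3 y3 le by linarith
  have i: "real i + 1 \<le> 8 ^ L" using y(2) by (metis Suc_eq_plus1 Suc_leI of_nat_1 of_nat_add of_nat_le_iff of_nat_numeral of_nat_power)
  \<comment> \<open>The following four bounds on offsets, put into \<open>A\<close> and
    \<open>B\<close>, show that \<open>4 * K\<close> and \<open>4 * L\<close> differ by at most
    2.\<close>
  have "- 1 \<le> eps K * (4 * real j * ?B - 1)"
  proof -
    have "eps K * (- 1) \<le> eps K * (4 * real j * ?B - 1)" using eps_pos[of K] by (intro mult_left_mono) auto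
    then show ?thesis using eps_le_1[of K] by linarith
  qed
  moreover have "- 1 \<le> eps L * (4 * real i - 1)"
  proof -
    have "eps L * (- 1) \<le> eps L * (4 * real i - 1)" using eps_pos[of L] by (intro mult_left_mono) auto
    then show ?thesis using eps_le_1[of L] by linarith
  qed
  moreover have "eps L * (4 * real i + 1) \<le> 1"
  proof -
    have "eps L * (4 * real i + 1) \<le> eps L * (4 * 8 ^ L)" using eps_pos[of L] i by (intro mult_left_mono) auto
    then show ?thesis using eps_bound_1[of L] by linarith
  qed
  moreover have "eps K * (4 * (real j + 1) * ?B - 3) \<le> 1"
  proof -
    have "eps K * (4 * (real j + 1) * ?B - 3) \<le> eps K * (4 * 8 ^ K)"
      using eps_pos[of K] node_index_bound[OF x(2,3)] by (intro mult_left_mono) (linarith, simp)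
    then show ?thesis using eps_bound_1[of K] by linarith
  qed
  ultimately show KL: "K = L" using A B by linarith
  have "4 * real j * ?B - 1 \<le> 4 * real i + 1" "4 * real i - 1 \<le> 4 * (real j + 1) * ?B - 3"
    using A B eps_pos[of K] unfolding KL by (simp_all add: mult_le_cancel_left)
  then have "real (4 * (j * 8 ^ (K - k))) \<le> real (4 * i + 2)"
    "real (4 * i + 2) \<le> real (4 * ((j + 1) * 8 ^ (K - k)))" by (simp_all add: algebra_simps)
  then have "4 * (j * 8 ^ (K - k)) \<le> 4 * i + 2" "4 * i + 2 \<le> 4 * ((j + 1) * 8 ^ (K - k))"
    unfolding of_nat_le_iff by blast+
  then have "j * 8 ^ (K - k) \<le> i" "i < (j + 1) * 8 ^ (K - k)" by linarith+
  then show "i div 8 ^ (K - k) = j" by (intro div_nat_eqI) (auto simp: algebra_simps)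
qed

text \<open>The first bound forces cubes joining a node to a leaf to be large; the second lets the
  cube of side \<open>3 / 2 ^ k\<close> starting at \<open>x\<close> reach the leaf. The 3 covers
  \<open>1 / 2 ^ k + 1 / 8 ^ k + 1 / 8 ^ K\<close> in the first direction.\<close>

lemma node_leaf_distance:
  assumes x: "x \<in> node K k (i div 8 ^ (K - k))" "k \<le> K" and y: "y \<in> leaf K i" "i < 8 ^ K"
  shows "1 / 2 ^ k \<le> y $ e1 - x $ e1"
    and "\<And>n. n \<in> {e1, e2, e3} \<Longrightarrow> x $ n \<le> y $ n \<and> y $ n \<le> x $ n + 3 / 2 ^ k"
proof -
  define j where "j = i div 8 ^ (K - k)"
  let ?B = "8 ^ (K - k) :: real"
  have "j * 8 ^ (K - k) \<le> i" "i + 1 \<le> (j + 1) * 8 ^ (K - k)"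
    using dividend_less_div_times[of "8 ^ (K - k)" i] by (auto simp: j_def)
  then have "real (j * 8 ^ (K - k)) \<le> real i" "real (i + 1) \<le> real ((j + 1) * 8 ^ (K - k))"
    unfolding of_nat_le_iff by blast+
  then have jB: "j * ?B \<le> i" "i + 1 \<le> (real j + 1) * ?B" by (simp_all add: algebra_simps)
  have "j < 8 ^ k"
    unfolding j_def using x(2) y(2)
    by (simp add: less_mult_imp_div_less flip: power_add)
  note jK = node_index_bound[OF x(2) this]
  have i: "real i + 1 \<le> 8 ^ K" using jB(2) jK by linarith
  have pw: "(1 :: real) / 2 ^ K \<le> 1 / 2 ^ k" "(1 :: real) / 8 ^ K \<le> 1 / 8 ^ k"
      "(1 :: real) / 8 ^ k \<le> 1 / 2 ^ k"
    using x(2) by (auto intro!: divide_left_mono power_increasing power_mono)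
  have x1: "x $ e1 \<in> {- (1 / 2 ^ k) - 1 / 8 ^ k .. - (1 / 2 ^ k)}"
    and x2: "x $ e2 \<in> {4 * real K + eps K * (4 * real j * ?B - 1) .. 4 * real K + eps K * (4 * real j * ?B)}"
    and x3: "- x $ e3 \<in> {4 * real K + eps K * (4 * (real j + 1) * ?B - 4) .. 4 * real K + eps K * (4 * (real j + 1) * ?B - 3)}"
    using x(1) by (auto simp: node_def brick_def j_def)
  have y1: "y $ e1 \<in> {0 .. 1 / 8 ^ K}"
    and y2: "y $ e2 \<in> {4 * real K + eps K * (4 * real i) .. 4 * real K + eps K * (4 * real i + 1)}"
    and y3: "- y $ e3 \<in> {4 * real K + eps K * (4 * real i - 1) .. 4 * real K + eps K * (4 * real i)}"
    using y(1) by (auto simp: leaf_def brick_def)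
  have mono: "eps K * s \<le> eps K * t" if "s \<le> t" for s t
    using that eps_pos[of K] by (intro mult_left_mono) auto
  \<comment> \<open>The extent of the whole tree along the antidiagonal is smaller than the scale of
    each of its levels.\<close>
  have top: "eps K * t \<le> eps K * s + 1 / 2 ^ k" if "t - s \<le> 4 * 8 ^ K" for s t
  proof -
    have "eps K * (t - s) \<le> 1 / (4 * 2 ^ K)" using mono[OF that] by (simp add: eps_bound)
    also have "\<dots> \<le> 1 / 2 ^ K" by (simp add: field_simps)
    finally show ?thesis using pw(1) by (simp add: algebra_simps)
  qed
  show "1 / 2 ^ k \<le> y $ e1 - x $ e1" using x1 y1 by auto
  fix n assume "n \<in> {e1, e2, e3}"
  moreover have "x $ e1 \<le> y $ e1 \<and> y $ e1 \<le> x $ e1 + 3 / 2 ^ k"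
  proof -
    have "x $ e1 \<le> 0" using x1 by (auto intro: order_trans)
    moreover have "(3 :: real) / 2 ^ k = 1 / 2 ^ k + 1 / 2 ^ k + 1 / 2 ^ k" by simp
    ultimately show ?thesis using x1 y1 pw by auto
  qed
  moreover have "x $ e2 \<le> y $ e2 \<and> y $ e2 \<le> x $ e2 + 3 / 2 ^ k"
  proof -
    have "eps K * (4 * real j * ?B) \<le> eps K * (4 * real i)" using jB by (intro mono) auto
    moreover have "eps K * (4 * real i + 1) \<le> eps K * (4 * real j * ?B - 1) + 1 / 2 ^ k"
      using i jB by (intro top) (auto simp: field_simps intro: add_increasing2)
    moreover have "(1 :: real) / 2 ^ k \<le> 3 / 2 ^ k" by (simp add: field_simps)
    ultimately show ?thesis using x2 y2 unfolding atLeastAtMost_iff by linarith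
  qed
  moreover have "x $ e3 \<le> y $ e3 \<and> y $ e3 \<le> x $ e3 + 3 / 2 ^ k"
  proof -
    have "eps K * (4 * real i) \<le> eps K * (4 * (real j + 1) * ?B - 4)" using jB(2) by (intro mono) linarith
    moreover have "eps K * (4 * (real j + 1) * ?B - 3) \<le> eps K * (4 * real i - 1) + 1 / 2 ^ k"
      using jK by (intro top) linarith
    moreover have "(1 :: real) / 2 ^ k \<le> 3 / 2 ^ k" by (simp add: field_simps)
    ultimately show ?thesis using x3 y3 unfolding atLeastAtMost_iff by linarith
  qed
  ultimately show "x $ n \<le> y $ n \<and> y $ n \<le> x $ n + 3 / 2 ^ k" by blast
qed

subsection \<open>The weights\<close>

definition leaves :: "nat \<Rightarrow> (real ^ 'n) set" where "leaves K = (\<Union>i<8 ^ K. leaf K i)"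

definition nodes :: "nat \<Rightarrow> (real ^ 'n) set" where "nodes K = (\<Union>k\<le>K. \<Union>j<8 ^ k. node K k j)"

definition w :: "real ^ 'n \<Rightarrow> real" where "w = indicator (\<Union>K. nodes K)"

text \<open>
  On \<open>leaves K\<close> the second coordinate lies in \<open>[4 * K, 4 * K + 4)\<close>, so the floor
  recovers \<open>K\<close>. The power is chosen such that the dual weight \<open>s\<close> of the leaves
  below a node and the volume \<open>t\<close> of that node satisfy \<open>t * s powr (p - 1) = (1 / 8 ^ k)
  powr p\<close>.
\<close>

definition v :: "real \<Rightarrow> real ^ 'n \<Rightarrow> real" where
  "v p x = (if x \<in> (\<Union>K. leaves K) then eps (nat \<lfloor>x $ e2 / 4\<rfloor>) powr (2 * p) else 1)"

lemma leaves_sets [measurable]: "leaves K \<in> sets borel"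
  unfolding leaves_def by measurable

lemma nodes_sets [measurable]: "nodes K \<in> sets borel"
  unfolding nodes_def by measurable

lemma v_leaves:
  assumes "x \<in> leaves K"
  shows "v p x = eps K powr (2 * p)"
proof -
  from assms obtain i where i: "i < 8 ^ K" and x: "x \<in> leaf K i" by (auto simp: leaves_def)
  have "Suc i \<le> 8 ^ K" using i by simp
  then have i': "real i + 1 \<le> 8 ^ K"
    by (metis of_nat_Suc of_nat_le_iff of_nat_numeral of_nat_power add.commute)
  have "eps K * (4 * real i + 1) < eps K * (4 * 8 ^ K)"
    using eps_pos[of K] i' by (intro mult_strict_left_mono) linarith+
  then have "eps K * (4 * real i + 1) < 1" using eps_bound_1[of K] by linarith
  moreover have "4 * real K + eps K * (4 * real i) \<le> x $ e2"
    "x $ e2 \<le> 4 * real K + eps K * (4 * real i + 1)"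
    using x by (auto simp: leaf_def brick_def)
  moreover have "0 \<le> eps K * (4 * real i)" using eps_pos[of K] by simp
  ultimately have "real K \<le> x $ e2 / 4" "x $ e2 / 4 < real K + 1" by linarith+
  then have "\<lfloor>x $ e2 / 4\<rfloor> = int K" by (intro floor_unique) simp_all
  then show ?thesis using assms by (auto simp: v_def)
qed

lemma v_off_leaves: "(\<And>K. x \<notin> leaves K) \<Longrightarrow> v p x = 1"
  by (auto simp: v_def)

lemma v_pos: "0 < v p x"
  using eps_pos by (auto simp: v_def less_le)

lemma v_le_1: "0 \<le> p \<Longrightarrow> v p x \<le> 1"
  using eps_pos eps_le_1 by (auto simp: v_def less_imp_le intro!: powr_le1)

lemma v_measurable [measurable]: "v p \<in> borel_measurable borel"
proof -
  have "(\<lambda>x. eps (nat \<lfloor>x $ e2 / 4\<rfloor>) powr (2 * p)) \<in> borel_measurable (borel :: (real ^ 'n) measure)"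
    by measurable
  then show ?thesis unfolding v_def[abs_def] by measurable
qed

lemma w_measurable [measurable]: "w \<in> borel_measurable borel"
  unfolding w_def by measurable

lemma locally_integrable_w: "locally_integrable w"
  by (rule locally_integrable_bounded[where B = 1])
    (auto simp: w_def indicator_def intro!: measurable_completion)

lemma locally_integrable_v: "0 \<le> p \<Longrightarrow> locally_integrable (v p)"
  using v_le_1[of p] v_pos[of p]
  by (intro locally_integrable_bounded[where B = 1])
    (auto simp: less_imp_le abs_of_pos intro!: measurable_completion)

lemma emeasure_cube:
  fixes z :: "real ^ 'n"
  assumes "0 \<le> h"
  shows "emeasure lebesgue (cbox z (z + vec h)) = ennreal (h ^ CARD('n))"
proof -
  have "cbox z (z + vec h) =
    {x. \<forall>i. x $ i \<in> (if i \<in> ({} :: 'n set) then {0..0} else {z $ i..z $ i + h})}"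
    by (auto simp: mem_box_cart)
  then show ?thesis
    using emeasure_cbox_cart[of "{}" "\<lambda>_. 0" "\<lambda>_. 0" h "($) z"] assms by simp
qed

text \<open>As \<open>Q\<close> meets leaves of at most one depth, the dual weight takes at most two
  values on it: 1 off the leaves, giving the volume term, and a fixed power of \<open>eps K\<close>
  on them.\<close>

lemma weighted_dual_le:
  fixes Q :: "(real ^ 'n) set"
  assumes [measurable]: "Q \<in> sets borel" and L: "\<And>L. Q \<inter> leaves L \<noteq> {} \<Longrightarrow> L = K"
  shows "weighted_measure (dual_weight p (v p)) Q \<le>
    emeasure lebesgue Q +
    ennreal (eps K powr (- (2 * p / (p - 1)))) * emeasure lebesgue (leaves K \<inter> Q)"
proof -
  let ?c = "ennreal (eps K powr (- (2 * p / (p - 1))))"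
  have "weighted_measure (dual_weight p (v p)) Q
      \<le> (\<integral>\<^sup>+x. indicator Q x + ?c * indicator (leaves K \<inter> Q) x \<partial>lebesgue)"
    unfolding weighted_measure_def
  proof (rule nn_integral_mono)
    fix x :: "real ^ 'n"
    show "ennreal (dual_weight p (v p) x) * indicator Q x
      \<le> indicator Q x + ?c * indicator (leaves K \<inter> Q) x"
    proof (cases "x \<in> Q \<and> x \<in> leaves K")
      case True
      then have "dual_weight p (v p) x = eps K powr (- (2 * p / (p - 1)))"
        using True by (simp add: dual_weight_def v_leaves[of x K] powr_powr)
      with True show ?thesis by simp
    next
      case False
      then have "v p x = 1" if "x \<in> Q" using L that by (intro v_off_leaves) blast
      with False show ?thesis by (auto simp: dual_weight_def indicator_def)
    qed
  qed
  also have "\<dots> = (\<integral>\<^sup>+x. indicator Q x \<partial>lebesgue) + (\<integral>\<^sup>+x. ?c * indicator (leaves K \<inter> Q) x \<partial>lebesgue)"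
    by (intro nn_integral_add measurable_completion) measurable
  also have "\<dots> = emeasure lebesgue Q + ?c * emeasure lebesgue (leaves K \<inter> Q)"
    by (subst nn_integral_cmult_indicator) auto
  finally show ?thesis .
qed

subsection \<open>The one-sided Muckenhoupt condition\<close>

lemma div_fiber: "0 < B \<Longrightarrow> {i. i div B = j} = {j * B..<(j + 1) * (B :: nat)}"
  using dividend_less_div_times[of B] by (auto simp: div_nat_eqI algebra_simps)

lemma sum_inverse_8_le: "(\<Sum>k\<in>{m..n}. 1 / 8 ^ k :: real) \<le> 2 / 8 ^ m"
proof (cases "m \<le> n")
  case True
  \<comment> \<open>The added term is the tail of the geometric series, so the left side stays
    constant during the induction.\<close>
  have "(\<Sum>k\<in>{m..n}. 1 / 8 ^ k :: real) + 1 / (7 * 8 ^ n) \<le> 2 / 8 ^ m"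
    using True by (induction n rule: dec_induct) (auto simp: field_simps)
  moreover have "0 \<le> 1 / (7 * 8 ^ n :: real)" by simp
  ultimately show ?thesis by linarith
qed auto

text \<open>The dual mass splits into a volume part, for which \<open>t \<le> h ^ CARD('n)\<close>
  suffices, and a leaf part \<open>s\<close>. For the latter, one node in the lower cube fixes the
  tree, and the topmost node met there controls both masses.\<close>

lemma adjacent_cubes_estimate:
  fixes a :: "real ^ 'n"
  assumes p: "1 < p" and d: "3 \<le> CARD('n)" and h: "0 < h"
    and ne: "weighted_measure w (cbox (a - vec h) a) \<noteq> 0"
  obtains t s where "0 \<le> t" "t \<le> h ^ CARD('n)" "0 \<le> s"
    "weighted_measure w (cbox (a - vec h) a) \<le> ennreal t"
    "weighted_measure (dual_weight p (v p)) (cbox a (a + vec h)) \<le> ennreal (h ^ CARD('n) + s)"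
    "t * s powr (p - 1) \<le> 2 * (8 * h ^ CARD('n)) powr p"
proof -
  define Q P where "Q = cbox (a - vec h) a" and "P = cbox a (a + vec h)"
  define m where "m = CARD('n) - 3"
  have [measurable]: "Q \<in> sets borel" "P \<in> sets borel" by (auto simp: Q_def P_def)
  have Qeq: "Q = cbox (a - vec h) (a - vec h + vec h)" by (simp add: Q_def)
  have mQ: "emeasure lebesgue Q = ennreal (h ^ CARD('n))" unfolding Qeq using h by (intro emeasure_cube) auto
  have mP: "emeasure lebesgue P = ennreal (h ^ CARD('n))" unfolding P_def using h by (intro emeasure_cube) auto
  have Qside: "Q \<subseteq> side (($) (a - vec h)) h" unfolding Qeq by (rule cbox_subset_side)
  have Pside: "P \<subseteq> side (($) a) h" unfolding P_def by (rule cbox_subset_side)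
  have wQ: "weighted_measure w Q = emeasure lebesgue ((\<Union>K. nodes K) \<inter> Q)"
    unfolding w_def by (intro weighted_measure_indicator) auto
  have le: "x $ n \<le> y $ n" if "x \<in> Q" "y \<in> P" for x y n
    using that unfolding Q_def P_def mem_box_cart by (meson order_trans)
  have "(\<Union>K. nodes K) \<inter> Q \<noteq> {}" using ne wQ unfolding Q_def[symmetric] by auto
  then obtain x1 K k1 j1 where x1: "x1 \<in> Q" "x1 \<in> node K k1 j1" "k1 \<le> K" "j1 < 8 ^ k1"
    by (auto simp: nodes_def)
  have "L = K" if "P \<inter> leaves L \<noteq> {}" for L
  proof -
    from that obtain y i where "y \<in> P" "y \<in> leaf L i" "i < 8 ^ L" by (auto simp: leaves_def)
    with node_below_leaf(1)[OF x1(2-4), of y L i] le[OF x1(1)] show ?thesis by simp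
  qed
  then have dual: "weighted_measure (dual_weight p (v p)) P \<le> ennreal (h ^ CARD('n)) +
      ennreal (eps K powr (- (2 * p / (p - 1)))) * emeasure lebesgue (leaves K \<inter> P)"
    using weighted_dual_le[of P K p] by (simp add: mP)
  have wQ1: "weighted_measure w Q \<le> ennreal (h ^ CARD('n))"
    unfolding wQ mQ[symmetric] by (intro emeasure_mono) auto
  show ?thesis
  proof (cases "leaves K \<inter> P = {}")
    case True
    \<comment> \<open>With \<open>s = 0\<close> the product vanishes, since
      \<open>0 powr (p - 1) = 0\<close>.\<close>
    show ?thesis
      by (rule that[of "h ^ CARD('n)" 0]) (use h dual wQ1 True in \<open>auto simp: Q_def P_def\<close>)
  next
    case False
    then obtain y i0 where y: "y \<in> P" "y \<in> leaf K i0" "i0 < 8 ^ K" by (auto simp: leaves_def)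
    define met where "met k \<longleftrightarrow> k \<le> K \<and> node K k (i0 div 8 ^ (K - k)) \<inter> Q \<noteq> {}" for k
    define k0 where "k0 = (LEAST k. met k)"
    have anc: "M = K \<and> j = i0 div 8 ^ (K - k)"
      if "x \<in> Q" "x \<in> node M k j" "k \<le> M" "j < 8 ^ k" for x M k j
      using node_below_leaf[OF that(2-4) y(2,3)] le[OF that(1) y(1)] by simp
    have "met k1" using anc[OF x1] x1 by (auto simp: met_def)
    then have met: "met k0" and least: "\<And>k. met k \<Longrightarrow> k0 \<le> k"
      unfolding k0_def by (auto intro: LeastI Least_le)
    then obtain x0 where x0: "x0 \<in> Q" "x0 \<in> node K k0 (i0 div 8 ^ (K - k0))" and k0: "k0 \<le> K"
      by (auto simp: met_def)
    \<comment> \<open>\<open>(eps K)\<^sup>2 * q\<close> is the volume of the topmost node inside a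
      slab of width \<open>h\<close>.\<close>
    define q where "q = h ^ m / 8 ^ k0"
    have "1 / 2 ^ k0 \<le> y $ e1 - x0 $ e1" using node_leaf_distance(1)[OF x0(2) k0 y(2,3)] .
    also have "\<dots> \<le> 2 * h"
    proof -
      have "a $ e1 - h \<le> x0 $ e1" "y $ e1 \<le> a $ e1 + h"
        using x0(1) y(1) by (auto simp: Q_def P_def mem_box_cart)
      then show ?thesis by linarith
    qed
    \<comment> \<open>Cubing turns the distance in one direction into the volume scale of three; the
      factor 8 arises here.\<close>
    finally have "(1 / 2 ^ k0) ^ 3 \<le> (2 * h) ^ 3" by (intro power_mono) auto
    moreover have "((1 :: real) / 2 ^ k0) ^ 3 = 1 / 8 ^ k0"
      using power_mult[of "2 :: real" 3 k0] power_mult[of "2 :: real" k0 3]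
      by (simp add: power_divide mult.commute)
    ultimately have "1 / 8 ^ k0 \<le> 8 * h ^ 3" by (simp add: power_mult_distrib)
    then have "1 / 8 ^ k0 * h ^ m \<le> 8 * h ^ 3 * h ^ m" using h by (intro mult_right_mono) auto
    moreover have "h ^ 3 * h ^ m = h ^ CARD('n)" using d by (simp add: m_def flip: power_add)
    ultimately have q: "0 < q" "q \<le> 8 * h ^ CARD('n)" using h by (auto simp: q_def mult.assoc)

    \<comment> \<open>Every node meeting \<open>Q\<close> is an ancestor of the leaf
      \<open>i0\<close>, so each level from \<open>k0\<close> on contributes at most one and the
      volumes form a geometric sum.\<close>
    have "(\<Union>K. nodes K) \<inter> Q \<subseteq>
        (\<Union>k\<in>{k0..K}. node K k (i0 div 8 ^ (K - k)) \<inter> side (($) (a - vec h)) h)"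
    proof
      fix x assume "x \<in> (\<Union>K. nodes K) \<inter> Q"
      then obtain M k j where x: "x \<in> Q" "x \<in> node M k j" "k \<le> M" "j < 8 ^ k"
        by (auto simp: nodes_def)
      then have "met k" using anc[OF x] by (auto simp: met_def)
      then show "x \<in> (\<Union>k\<in>{k0..K}. node K k (i0 div 8 ^ (K - k)) \<inter> side (($) (a - vec h)) h)"
        using least[of k] anc[OF x] x Qside by auto
    qed
    then have "weighted_measure w Q \<le>
        emeasure lebesgue (\<Union>k\<in>{k0..K}. node K k (i0 div 8 ^ (K - k)) \<inter> side (($) (a - vec h)) h)"
      unfolding wQ by (intro emeasure_mono) auto
    also have "\<dots> \<le> ennreal (\<Sum>k\<in>{k0..K}. (eps K)\<^sup>2 / 8 ^ k * h ^ m)"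
      using h by (intro emeasure_UN_le_card) (auto simp: emeasure_node_side m_def)
    also have "\<dots> \<le> ennreal (2 * (eps K)\<^sup>2 * q)"
    proof (rule ennreal_leI)
      have "(\<Sum>k\<in>{k0..K}. (eps K)\<^sup>2 / 8 ^ k * h ^ m) = (eps K)\<^sup>2 * h ^ m * (\<Sum>k\<in>{k0..K}. 1 / 8 ^ k)"
        by (simp add: sum_distrib_left mult_ac)
      also have "\<dots> \<le> (eps K)\<^sup>2 * h ^ m * (2 / 8 ^ k0)"
        using h by (intro mult_left_mono sum_inverse_8_le) auto
      finally show "(\<Sum>k\<in>{k0..K}. (eps K)\<^sup>2 / 8 ^ k * h ^ m) \<le> 2 * (eps K)\<^sup>2 * q"
        by (simp add: q_def mult_ac)
    qed
    finally have wQ2: "weighted_measure w Q \<le> ennreal (2 * (eps K)\<^sup>2 * q)" .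

    \<comment> \<open>Every leaf meeting \<open>P\<close> lies above \<open>x0\<close> and hence
      descends from the topmost node.\<close>
    let ?I = "{i. i div 8 ^ (K - k0) = i0 div 8 ^ (K - k0)}"
    have fin: "finite ?I" and cardI: "card ?I = 8 ^ (K - k0)" by (simp_all add: div_fiber)
    have "leaves K \<inter> P \<subseteq> (\<Union>i\<in>?I. leaf K i \<inter> side (($) a) h)"
    proof
      fix z assume "z \<in> leaves K \<inter> P"
      then obtain i where z: "z \<in> P" "z \<in> leaf K i" "i < 8 ^ K" by (auto simp: leaves_def)
      have "i0 div 8 ^ (K - k0) < 8 ^ k0"
        using k0 y(3) by (simp add: less_mult_imp_div_less flip: power_add)
      from node_below_leaf(2)[OF x0(2) k0 this z(2,3)] le[OF x0(1) z(1)]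
      show "z \<in> (\<Union>i\<in>?I. leaf K i \<inter> side (($) a) h)" using z Pside by auto
    qed
    then have "emeasure lebesgue (leaves K \<inter> P) \<le> emeasure lebesgue (\<Union>i\<in>?I. leaf K i \<inter> side (($) a) h)"
      by (intro emeasure_mono) (auto intro!: sets.finite_UN fin)
    also have "\<dots> \<le> ennreal (\<Sum>i\<in>?I. (eps K)\<^sup>2 / 8 ^ K * h ^ m)"
      using h by (intro emeasure_UN_le_card fin) (auto simp: emeasure_leaf_side m_def)
    also have "(\<Sum>i\<in>?I. (eps K)\<^sup>2 / 8 ^ K * h ^ m) = (eps K)\<^sup>2 * q"
    proof -
      have "(8 :: real) ^ K = 8 ^ (K - k0) * 8 ^ k0" using k0 by (simp flip: power_add)
      then show ?thesis using cardI by (simp add: q_def)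
    qed
    finally have lP: "emeasure lebesgue (leaves K \<inter> P) \<le> ennreal ((eps K)\<^sup>2 * q)" .

    define s where "s = eps K powr (- (2 * p / (p - 1))) * ((eps K)\<^sup>2 * q)"
    define t where "t = min (2 * (eps K)\<^sup>2 * q) (h ^ CARD('n))"
    have s: "0 \<le> s" using q by (simp add: s_def)
    have "weighted_measure (dual_weight p (v p)) P \<le> ennreal (h ^ CARD('n)) +
        ennreal (eps K powr (- (2 * p / (p - 1)))) * ennreal ((eps K)\<^sup>2 * q)"
      using dual lP by (meson add_left_mono mult_left_mono order_trans zero_le)
    also have "\<dots> = ennreal (h ^ CARD('n) + s)"
      using q h by (simp add: s_def flip: ennreal_mult' ennreal_plus)
    finally have S: "weighted_measure (dual_weight p (v p)) P \<le> ennreal (h ^ CARD('n) + s)" .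
    have "t * s powr (p - 1) \<le> 2 * (eps K)\<^sup>2 * q * s powr (p - 1)"
      unfolding t_def by (intro mult_right_mono) auto
    \<comment> \<open>The exponents \<open>2\<close>, \<open>- (2 * p)\<close> and
      \<open>2 * (p - 1)\<close> of \<open>eps K\<close> cancel, which is the purpose of the power
      in \<open>v\<close>.\<close>
    also have "\<dots> = 2 * q powr p"
    proof -
      have e: "(eps K)\<^sup>2 = eps K powr 2" using eps_pos[of K] by (simp add: powr_numeral)
      have "s powr (p - 1) = eps K powr (- (2 * p)) * (eps K powr (2 * (p - 1)) * q powr (p - 1))"
        using q p eps_pos[of K] unfolding s_def e by (simp add: powr_mult powr_powr del: powr_numeral)
      then have "2 * (eps K)\<^sup>2 * q * s powr (p - 1) =
          2 * (eps K powr (2 + - (2 * p) + 2 * (p - 1))) * (q powr 1 * q powr (p - 1))"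
        using q unfolding e powr_add by simp
      also have "\<dots> = 2 * q powr p" using eps_pos[of K] q by (simp only: powr_add[symmetric]) simp
      finally show ?thesis .
    qed
    also have "\<dots> \<le> 2 * (8 * h ^ CARD('n)) powr p" using q p by (intro mult_left_mono powr_mono2) auto
    finally have ts: "t * s powr (p - 1) \<le> 2 * (8 * h ^ CARD('n)) powr p" .
    show ?thesis
    proof (rule that[of t s])
      show "0 \<le> t" using q h by (simp add: t_def)
      show "t \<le> h ^ CARD('n)" by (simp add: t_def)
      show "weighted_measure w (cbox (a - vec h) a) \<le> ennreal t"
        using wQ1 wQ2 unfolding Q_def t_def min_def by auto
    qed (use s S ts in \<open>simp_all add: P_def\<close>)
  qed
qed

lemma A_plus_bounded:
  assumes p: "1 < p" and d: "3 \<le> CARD('n)"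
  shows "A_plus p w (v p) < \<infinity>"
proof -
  let ?B = "2 powr (p - 1) * (2 * 8 powr p)"
  have "A_plus p w (v p) \<le> ennreal ?B"
    unfolding A_plus_def
  proof (intro SUP_least)
    fix a :: "real ^ 'n" and h :: real assume "h \<in> {0<..}"
    then have h: "0 < h" by simp
    define H where "H = h ^ CARD('n)"
    have H: "0 < H" using h by (simp add: H_def)
    have hp: "h powr (real CARD('n) * p) = H powr p"
      using h by (simp add: H_def powr_powr flip: powr_realpow)
    let ?W = "weighted_measure w (cbox (a - vec h) a)"
    let ?S = "weighted_measure (dual_weight p (v p)) (cbox a (a + vec h))"
    have "?W * ennreal_powr ?S (p - 1) \<le> ennreal ?B * ennreal (H powr p)"
    proof (cases "?W = 0")
      case False
      from adjacent_cubes_estimate[OF p d h False, folded H_def]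
      obtain t s where t: "0 \<le> t" "t \<le> H" and s: "0 \<le> s" and W: "?W \<le> ennreal t"
        and S: "?S \<le> ennreal (H + s)" and ts: "t * s powr (p - 1) \<le> 2 * (8 * H) powr p" by metis
      have "?W * ennreal_powr ?S (p - 1) \<le> ennreal t * ennreal_powr (ennreal (H + s)) (p - 1)"
        using W S p by (intro mult_mono ennreal_powr_mono) auto
      also have "\<dots> = ennreal (t * (H + s) powr (p - 1))"
        using t s H ennreal_powr_ennreal[of "H + s" "p - 1"] by (simp add: ennreal_mult' del: ennreal_plus)
      also have "\<dots> \<le> ennreal (?B * H powr p)"
      \<comment> \<open>Replacing \<open>H + s\<close> by twice the larger summand costs
        \<open>2 powr (p - 1)\<close>; then \<open>t \<le> H\<close> handles the volume part and
        \<open>ts\<close> the leaf part.\<close>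
      proof (rule ennreal_leI, cases "s \<le> H")
        case True
        have "t * (H + s) powr (p - 1) \<le> H * (2 * H) powr (p - 1)"
          using t s H p True by (intro mult_mono powr_mono2) auto
        also have "\<dots> = 2 powr (p - 1) * (H powr 1 * H powr (p - 1))" using H by (simp add: powr_mult)
        also have "\<dots> = 2 powr (p - 1) * 1 * H powr p" using H by (simp only: powr_add[symmetric]) simp
        also have "\<dots> \<le> ?B * H powr p"
          using p ge_one_powr_ge_zero[of 8 p] by (intro mult_right_mono mult_left_mono) auto
        finally show "t * (H + s) powr (p - 1) \<le> ?B * H powr p" .
      next
        case False
        have "t * (H + s) powr (p - 1) \<le> t * (2 * s) powr (p - 1)"
          using t s H p False by (intro mult_left_mono powr_mono2) auto
        also have "\<dots> = 2 powr (p - 1) * (t * s powr (p - 1))" using s by (simp add: powr_mult)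
        also have "\<dots> \<le> 2 powr (p - 1) * (2 * (8 * H) powr p)" using ts by (intro mult_left_mono) auto
        also have "\<dots> = ?B * H powr p" using H by (simp add: powr_mult)
        finally show "t * (H + s) powr (p - 1) \<le> ?B * H powr p" .
      qed
      also have "\<dots> = ennreal ?B * ennreal (H powr p)" by (simp add: ennreal_mult')
      finally show ?thesis .
    qed simp
    then show "?W * ennreal_powr ?S (p - 1) / ennreal (h powr (real CARD('n) * p)) \<le> ennreal ?B"
      unfolding hp using H by (intro divide_le_posI_ennreal) (auto simp: mult.commute)
  qed
  also have "\<dots> < \<infinity>" by simp
  finally show ?thesis .
qed

subsection \<open>Failure of the weak type inequality\<close>

lemma leaf_disjoint:
  assumes "x \<in> leaf K i" "x \<in> leaf K i'"
  shows "i = i'"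
proof -
  have "i \<le> i'" if "x \<in> leaf K i" "x \<in> leaf K i'" for i i'
  proof -
    have "eps K * (4 * real i) \<le> eps K * (4 * real i' + 1)"
      using that by (auto simp: leaf_def brick_def)
    then have "4 * real i \<le> 4 * real i' + 1" using eps_pos[of K] by (simp add: mult_le_cancel_left)
    then show ?thesis by linarith
  qed
  then show ?thesis using assms by (meson antisym)
qed

text \<open>Levels are separated in the first direction, since
  \<open>1 / 2 ^ k' + 1 / 8 ^ k' < 1 / 2 ^ k\<close> for \<open>k < k'\<close>; within a level the
  second intervals are. Disjointness lets the masses of the nodes add up.\<close>

lemma node_disjoint:
  assumes "x \<in> node K k j" "x \<in> node K k' j'"
  shows "k = k' \<and> j = j'"
proof -
  have "k' \<le> k" if "x \<in> node K k j" "x \<in> node K k' j'" for k j k' j'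
  proof (rule ccontr)
    assume "\<not> k' \<le> k"
    then have "Suc k \<le> k'" by simp
    then have "(1 :: real) / 2 ^ k' \<le> 1 / 2 ^ Suc k" "(1 :: real) / 8 ^ k' \<le> 1 / 8 ^ Suc k"
      "(1 :: real) / 8 ^ k \<le> 1 / 2 ^ k"
      by (intro divide_left_mono power_increasing power_mono; simp)+
    moreover have "- (1 / 2 ^ k') - 1 / 8 ^ k' \<le> - (1 / 2 ^ k :: real)"
      using that by (auto simp: node_def brick_def)
    moreover have "(0 :: real) < 1 / 2 ^ k" by simp
    ultimately show False by simp
  qed
  then have k: "k = k'" using assms by (meson antisym)
  have "j \<le> j'" if "x \<in> node K k j" "x \<in> node K k j'" for j j'
  proof (rule ccontr)
    assume "\<not> j \<le> j'"
    then have "real j' + 1 \<le> real j" by simp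
    then have "(real j' + 1) * 8 ^ (K - k) \<le> real j * 8 ^ (K - k)" by (rule mult_right_mono) simp
    moreover have "eps K * (4 * real j * 8 ^ (K - k) - 1) \<le> eps K * (4 * real j' * 8 ^ (K - k))"
      using that by (auto simp: node_def brick_def)
    then have "4 * real j * 8 ^ (K - k) - 1 \<le> 4 * real j' * 8 ^ (K - k)"
      using eps_pos[of K] by (simp add: mult_le_cancel_left)
    moreover have "(1 :: real) \<le> 8 ^ (K - k)" by simp
    ultimately show False by (simp add: algebra_simps)
  qed
  with k assms show ?thesis by (meson antisym)
qed

text \<open>The cutoff makes the norm finite. Its width 4 is the width 1 of the slab of nodes plus
  the largest cube side 3, so the cubes used do not notice it.\<close>

definition test :: "nat \<Rightarrow> real ^ 'n \<Rightarrow> real" where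
  "test K = indicator (leaves K \<inter> side (\<lambda>_. 0) 4)"

lemma test_measurable [measurable]: "test K \<in> borel_measurable borel"
  unfolding test_def by measurable

text \<open>The leaves have total volume of order \<open>(eps K)\<^sup>2\<close>. The weight is
  written as \<open>(eps K)\<^sup>2 powr p\<close> so that the root leaves a factor
  \<open>(eps K)\<^sup>2\<close>, the order of the maximal function on the nodes.\<close>

lemma Lp_norm_test:
  assumes p: "1 < p"
  shows "Lp_norm p (v p) (test K) \<le> ennreal (((eps K)\<^sup>2 * (eps K)\<^sup>2 powr p * 4 ^ (CARD('n) - 3)) powr (1 / p))"
proof -
  let ?m = "CARD('n) - 3"
  have "(\<integral>\<^sup>+x. ennreal (\<bar>test K x\<bar> powr p * v p x) \<partial>lebesgue)
      = (\<integral>\<^sup>+x. ennreal (eps K powr (2 * p)) * indicator (leaves K \<inter> side (\<lambda>_. 0) 4) x \<partial>lebesgue)"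
    using p by (intro nn_integral_cong) (auto simp: test_def indicator_def v_leaves)
  also have "\<dots> = ennreal (eps K powr (2 * p)) * emeasure lebesgue (leaves K \<inter> side (\<lambda>_. 0) 4)"
    by (intro nn_integral_cmult_indicator) auto
  also have "\<dots> \<le> ennreal (eps K powr (2 * p)) * ennreal ((eps K)\<^sup>2 * 4 ^ ?m)"
  proof (rule mult_left_mono)
    have "leaves K \<inter> side (\<lambda>_. 0) 4 = (\<Union>i<8 ^ K. leaf K i \<inter> side (\<lambda>_. 0) 4)"
      by (auto simp: leaves_def)
    also have "emeasure lebesgue \<dots> \<le> ennreal (\<Sum>i<(8 :: nat) ^ K. (eps K)\<^sup>2 / 8 ^ K * 4 ^ ?m)"
      by (intro emeasure_UN_le_card) (auto simp: emeasure_leaf_side)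
    also have "(\<Sum>i<(8 :: nat) ^ K. (eps K)\<^sup>2 / 8 ^ K * 4 ^ ?m) = (eps K)\<^sup>2 * 4 ^ ?m" by simp
    finally show "emeasure lebesgue (leaves K \<inter> side (\<lambda>_. 0) 4) \<le> ennreal ((eps K)\<^sup>2 * 4 ^ ?m)" .
  qed simp
  also have "ennreal (eps K powr (2 * p)) * ennreal ((eps K)\<^sup>2 * 4 ^ ?m)
      = ennreal ((eps K)\<^sup>2 * (eps K)\<^sup>2 powr p * 4 ^ ?m)"
  proof -
    have "(eps K)\<^sup>2 powr p = eps K powr (2 * p)"
      using eps_pos[of K] powr_numeral[of "eps K" "num.Bit0 num.One"] by (simp flip: powr_powr)
    then show ?thesis by (simp add: mult_ac flip: ennreal_mult')
  qed
  finally have "Lp_norm p (v p) (test K) \<le>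
      ennreal_powr (ennreal ((eps K)\<^sup>2 * (eps K)\<^sup>2 powr p * 4 ^ ?m)) (1 / p)"
    unfolding Lp_norm_def using p by (intro ennreal_powr_mono) auto
  then show ?thesis by (subst (asm) ennreal_powr_ennreal) auto
qed

text \<open>The cube of side \<open>3 / 2 ^ k\<close> at \<open>x\<close> contains the slices of all
  leaves below the node. Leaf volume and cube volume both carry \<open>1 / 8 ^ k\<close>, so the
  bound is the same on all levels.\<close>

lemma maximal_test_ge:
  assumes x: "x \<in> node K k j" "k \<le> K" "j < 8 ^ k" "x \<in> side (\<lambda>_. 0) 1" and d: "3 \<le> CARD('n)"
  shows "ennreal ((eps K)\<^sup>2 / 27) \<le> one_sided_maximal (test K) x"
proof -
  define h :: real where "h = 3 / 2 ^ k"
  define m where "m = CARD('n) - 3"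
  define I where "I = {i. i div 8 ^ (K - k) = j}"
  have fin: "finite I" and cardI: "card I = 8 ^ (K - k)" by (simp_all add: I_def div_fiber)
  have h: "0 < h" "h \<le> 3" by (simp_all add: h_def field_simps)
  have I8: "i < 8 ^ K" if "i \<in> I" for i
  proof -
    have "i div 8 ^ (K - k) < 8 ^ k" using that x(3) by (simp add: I_def)
    then have "i < 8 ^ k * 8 ^ (K - k)" by (simp add: div_less_iff_less_mult)
    then show ?thesis using x(2) by (simp flip: power_add)
  qed
  have sub: "(\<Union>i\<in>I. leaf K i \<inter> side (($) x) h) \<subseteq> leaves K \<inter> side (\<lambda>_. 0) 4 \<inter> cbox x (x + vec h)"
  proof
    fix y assume "y \<in> (\<Union>i\<in>I. leaf K i \<inter> side (($) x) h)"
    then obtain i where i: "i \<in> I" and y: "y \<in> leaf K i" "y \<in> side (($) x) h" by auto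
    have xi: "x \<in> node K k (i div 8 ^ (K - k))" using x i by (simp add: I_def)
    have "x $ n \<le> y $ n \<and> y $ n \<le> x $ n + h" for n
      using node_leaf_distance(2)[OF xi x(2) y(1) I8[OF i], of n] y(2)
      by (cases "n \<in> {e1, e2, e3}") (auto simp: side_def h_def)
    moreover have "y \<in> side (\<lambda>_. 0) 4"
      unfolding side_def mem_Collect_eq
    proof (intro allI impI)
      fix n assume "n \<notin> {e1, e2, e3}"
      then have "x $ n \<in> {0..0 + 1}" "y $ n \<in> {x $ n..x $ n + h}"
        using x(4) y(2) unfolding side_def by blast+
      then show "y $ n \<in> {0..0 + 4}" using h by auto
    qed
    moreover have "y \<in> leaves K" using y I8[OF i] by (auto simp: leaves_def)
    ultimately show "y \<in> leaves K \<inter> side (\<lambda>_. 0) 4 \<inter> cbox x (x + vec h)"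
      by (auto simp: mem_box_cart)
  qed
  have "h ^ CARD('n) = h ^ 3 * h ^ m" using d by (simp add: m_def flip: power_add)
  moreover have "h ^ 3 = 27 / 8 ^ k"
    using power_mult[of "2 :: real" 3 k] power_mult[of "2 :: real" k 3]
    by (simp add: h_def power_divide mult.commute)
  moreover have "(8 :: real) ^ K = 8 ^ (K - k) * 8 ^ k" using x(2) by (simp flip: power_add)
  ultimately have "ennreal ((eps K)\<^sup>2 / 27) =
      ennreal ((\<Sum>i\<in>I. (eps K)\<^sup>2 / 8 ^ K * h ^ m) / h ^ CARD('n))"
    using h cardI by (simp add: field_simps)
  also have "\<dots> = ennreal (\<Sum>i\<in>I. (eps K)\<^sup>2 / 8 ^ K * h ^ m) / ennreal (h ^ CARD('n))"
    using h by (subst divide_ennreal) (auto intro!: sum_nonneg)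
  also have "ennreal (\<Sum>i\<in>I. (eps K)\<^sup>2 / 8 ^ K * h ^ m) =
      (\<Sum>i\<in>I. emeasure lebesgue (leaf K i \<inter> side (($) x) h))"
    using h by (subst sum_ennreal[symmetric]) (auto simp: emeasure_leaf_side m_def simp del: sum_ennreal sum_constant)
  also have "\<dots> = emeasure lebesgue (\<Union>i\<in>I. leaf K i \<inter> side (($) x) h)"
    using fin by (intro sum_emeasure) (auto simp: disjoint_family_on_def dest: leaf_disjoint)
  also have "\<dots> \<le> emeasure lebesgue (leaves K \<inter> side (\<lambda>_. 0) 4 \<inter> cbox x (x + vec h))"
    using sub by (intro emeasure_mono) auto
  also have "\<dots> = (\<integral>\<^sup>+y. indicator (leaves K \<inter> side (\<lambda>_. 0) 4 \<inter> cbox x (x + vec h)) y \<partial>lebesgue)"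
    by (intro nn_integral_indicator[symmetric]) auto
  also have "\<dots> = (\<integral>\<^sup>+y\<in>cbox x (x + vec h). ennreal \<bar>test K y\<bar> \<partial>lebesgue)"
    by (intro nn_integral_cong) (auto simp: test_def indicator_def)
  finally have "ennreal ((eps K)\<^sup>2 / 27) \<le>
      (\<integral>\<^sup>+y\<in>cbox x (x + vec h). ennreal \<bar>test K y\<bar> \<partial>lebesgue) / ennreal (h ^ CARD('n))"
    by (simp add: divide_right_mono_ennreal)
  also have "\<dots> \<le> one_sided_maximal (test K) x"
    unfolding one_sided_maximal_def using h by (intro SUP_upper) auto
  finally show ?thesis .
qed

text \<open>Each of the \<open>K + 1\<close> levels has \<open>8 ^ k\<close> nodes of volume
  \<open>(eps K)\<^sup>2 / 8 ^ k\<close> in the slab.\<close>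

lemma weighted_measure_nodes:
  "weighted_measure w (nodes K \<inter> side (\<lambda>_. 0) 1) = ennreal (real (K + 1) * (eps K)\<^sup>2)"
proof -
  let ?J = "SIGMA k:{..K}. {..<(8 :: nat) ^ k}"
  have "weighted_measure w (nodes K \<inter> side (\<lambda>_. 0) 1)
      = emeasure lebesgue ((\<Union>K. nodes K) \<inter> (nodes K \<inter> side (\<lambda>_. 0) 1))"
    unfolding w_def by (intro weighted_measure_indicator) auto
  also have "(\<Union>K. nodes K) \<inter> (nodes K \<inter> side (\<lambda>_. 0) 1) =
      (\<Union>(k, j)\<in>?J. node K k j \<inter> side (\<lambda>_. 0) 1)"
    by (auto simp: nodes_def)
  also have "emeasure lebesgue \<dots> = (\<Sum>(k, j)\<in>?J. emeasure lebesgue (node K k j \<inter> side (\<lambda>_. 0) 1))"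
    unfolding case_prod_beta
    by (intro sum_emeasure[symmetric]) (auto simp: disjoint_family_on_def dest: node_disjoint)
  also have "\<dots> = (\<Sum>(k, j)\<in>?J. ennreal ((eps K)\<^sup>2 / 8 ^ k))"
    by (intro sum.cong) (auto simp: emeasure_node_side)
  also have "\<dots> = ennreal (\<Sum>(k, j)\<in>?J. (eps K)\<^sup>2 / 8 ^ k)"
    unfolding case_prod_beta by (intro sum_ennreal) auto
  also have "(\<Sum>(k, j)\<in>?J. (eps K)\<^sup>2 / 8 ^ k) = (\<Sum>k\<le>K. \<Sum>j<(8::nat) ^ k. (eps K)\<^sup>2 / 8 ^ k)"
    by (subst sum.Sigma) auto
  also have "\<dots> = real (K + 1) * (eps K)\<^sup>2" by simp
  finally show ?thesis .
qed

text \<open>Testing with \<open>test K\<close>, all powers of \<open>eps K\<close> cancel, and the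
  number of levels is left against a bound independent of \<open>K\<close>.\<close>

lemma weak_type_constant_ge:
  assumes p: "1 < p" and d: "3 \<le> CARD('n)" and c: "0 \<le> c"
    and C: "\<forall>f\<in>Lp_space p (v p). weak_Lp_norm p w (one_sided_maximal f) \<le> ennreal c * Lp_norm p (v p) f"
  shows "real (K + 1) powr (1 / p) \<le> 28 * c * (4 ^ (CARD('n) - 3)) powr (1 / p)"
proof -
  let ?e = "(eps K)\<^sup>2" and ?M = "4 ^ (CARD('n) - 3) :: real"
  have e: "0 < ?e" using eps_pos[of K] by simp
  have "test K \<in> Lp_space p (v p)"
    unfolding Lp_space_def using le_less_trans[OF Lp_norm_test[OF p] ennreal_less_top]
    by (auto intro!: measurable_completion)
  note bound = bspec[OF C this]
  \<comment> \<open>The level 28 in place of 27 yields the strict inequality that the weak norm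
    requires.\<close>
  have "nodes K \<inter> side (\<lambda>_. 0) 1 \<subseteq> {x. ennreal (?e / 28) < one_sided_maximal (test K) x}"
  proof
    fix x assume "x \<in> nodes K \<inter> side (\<lambda>_. 0) 1"
    then obtain k j where "x \<in> node K k j" "k \<le> K" "j < 8 ^ k" "x \<in> side (\<lambda>_. 0) 1"
      by (auto simp: nodes_def)
    from maximal_test_ge[OF this d] have "ennreal (?e / 27) \<le> one_sided_maximal (test K) x" .
    moreover have "ennreal (?e / 28) < ennreal (?e / 27)" using e by (intro ennreal_lessI) auto
    ultimately show "x \<in> {x. ennreal (?e / 28) < one_sided_maximal (test K) x}" by auto
  qed
  then have level: "ennreal (real (K + 1) * ?e) \<le>
      weighted_measure w {x. ennreal (?e / 28) < one_sided_maximal (test K) x}"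
    using weighted_measure_mono weighted_measure_nodes by metis
  have "ennreal (?e / 28 * (real (K + 1) * ?e) powr (1 / p))
      = ennreal (?e / 28) * ennreal_powr (ennreal (real (K + 1) * ?e)) (1 / p)"
    by (subst ennreal_powr_ennreal, simp, rule ennreal_mult') simp
  also have "\<dots> \<le> ennreal (?e / 28) * ennreal_powr
      (weighted_measure w {x. ennreal (?e / 28) < one_sided_maximal (test K) x}) (1 / p)"
    using p by (intro mult_left_mono ennreal_powr_mono level) auto
  also have "\<dots> \<le> weak_Lp_norm p w (one_sided_maximal (test K))"
    unfolding weak_Lp_norm_def using e by (intro SUP_upper) auto
  also have "\<dots> \<le> ennreal c * Lp_norm p (v p) (test K)" by (rule bound)
  also have "\<dots> \<le> ennreal c * ennreal ((?e * ?e powr p * ?M) powr (1 / p))"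
    by (intro mult_left_mono Lp_norm_test p) auto
  also have "\<dots> = ennreal (c * (?e * ?e powr p * ?M) powr (1 / p))" using c by (simp add: ennreal_mult')
  finally have "?e / 28 * (real (K + 1) * ?e) powr (1 / p) \<le> c * (?e * ?e powr p * ?M) powr (1 / p)"
    using c by (subst (asm) ennreal_le_iff) auto
  also have "\<dots> = c * (?e powr (1 / p) * ?e * ?M powr (1 / p))"
    using p e by (simp add: powr_mult powr_powr)
  also have "?e / 28 * (real (K + 1) * ?e) powr (1 / p) = ?e * ?e powr (1 / p) * (real (K + 1) powr (1 / p) / 28)"
    by (simp add: powr_mult)
  finally have "?e * ?e powr (1 / p) * (real (K + 1) powr (1 / p) / 28)
      \<le> ?e * ?e powr (1 / p) * (c * ?M powr (1 / p))" by (simp only: mult_ac)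
  then have "real (K + 1) powr (1 / p) / 28 \<le> c * ?M powr (1 / p)"
    using e by (subst (asm) mult_le_cancel_left_pos) auto
  then show ?thesis by simp
qed

lemma maximal_weak_type_norm_infinite:
  assumes p: "1 < p" and d: "3 \<le> CARD('n)"
  shows "maximal_weak_type_norm p (v p) w = \<infinity>"
proof -
  have "C = \<infinity>" if C: "\<forall>f\<in>Lp_space p (v p).
      weak_Lp_norm p w (one_sided_maximal f) \<le> C * Lp_norm p (v p) f" for C
  proof (rule ccontr)
    assume "C \<noteq> \<infinity>"
    then obtain c where c: "C = ennreal c" "0 \<le> c" by (cases C) auto
    let ?R = "28 * c * (4 ^ (CARD('n) - 3)) powr (1 / p)"
    obtain K where K: "?R powr p < real K" using reals_Archimedean2 by blast
    have "real (K + 1) powr (1 / p) \<le> ?R" using weak_type_constant_ge[OF p d c(2)] C c by simp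
    then have "(real (K + 1) powr (1 / p)) powr p \<le> ?R powr p" using p by (intro powr_mono2) auto
    then show False using K p by (simp add: powr_powr)
  qed
  then show ?thesis unfolding maximal_weak_type_norm_def by (intro antisym) (auto intro!: Inf_greatest)
qed

end

theorem theorem1p1:
  fixes p :: real
  assumes "1 < p" and "3 \<le> CARD('n::finite)"
  shows "\<exists>w v :: real ^ 'n \<Rightarrow> real.
    (\<forall>x. 0 \<le> w x) \<and> locally_integrable w \<and>
    (\<forall>x. 0 < v x) \<and> locally_integrable v \<and>
    A_plus p w v < \<infinity> \<and> maximal_weak_type_norm p v w = \<infinity>"
proof -
  obtain S :: "'n set" where "card S = 3" using obtain_subset_with_card_n[OF assms(2)] by blast
  then obtain e1 e2 e3 :: 'n where "e1 \<noteq> e2" "e1 \<noteq> e3" "e2 \<noteq> e3" by (auto simp: card_3_iff)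
  then interpret three_directions e1 e2 e3 by unfold_locales
  have "0 \<le> w x" for x by (simp add: w_def)
  then show ?thesis
    using locally_integrable_w v_pos[of p] locally_integrable_v[of p] A_plus_bounded[OF assms]
      maximal_weak_type_norm_infinite[OF assms] assms(1)
    by (intro exI[of _ w] exI[of _ "v p"]) auto
qed

end
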